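(* Let $c\geq 0$ and $b\geq 2$ be integers and let $u\in U_{[c,b]}$. Set $d=\gcd(2,b-1)$. Then there exist arbitrarily long finite sequences of $d$-consecutive $u$-attracted numbers for $S_{[c,b]}$.
   Context: For integers $c\ge 0$, $b\ge 2$, the function $S_{[c,b]}:\mathbb{Z}^+\to\mathbb{Z}^+$ is defined by $S_{[c,b]}(a)=c+\sum_{i=0}^n a_i^2$, where $a=\sum_{i=0}^n a_i b^i$ with integers $0\le a_i\le b-1$ is the base-$b$ expansion of the positive integer $a$. $S_{[c,b]}^k$ denotes the $k$-fold iterate ($S_{[c,b]}^0$ is the identity). $U_{[c,b]}=\{a\in\mathbb{Z}^+ \mid S_{[c,b]}^m(a)=a \text{ for some } m\in\mathbb{Z}^+\}$ is the set of all elements of fixed points and cycles of $S_{[c,b]}$. For $u\in U_{[c,b]}$, a positive integer $a$ is a $u$-attracted number (for $S_{[c,b]}$) if $S_{[c,b]}^k(a)=u$ for some $k\in\mathbb{Z}_{\ge 0}$. A sequence of positive integers is $d$-consecutive if it is an arithmetic sequence with constant difference $d$. "Arbitrarily long" means: for every $N\in\mathbb{Z}^+$ there is such a sequence with $N$ terms. *)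

theory Defs
  imports Complex_Main
begin

text \<open>
  The coefficient of \<open>b ^ i\<close> in the base-\<open>b\<close> expansion of \<open>a\<close> is \<open>a div b ^ i mod b\<close>.
  For \<open>b \<ge> 2\<close> it vanishes for all \<open>i > a\<close>, since then \<open>a < b ^ i\<close>; hence
  summing over \<open>i \<le> a\<close> covers every digit, and the extra leading zeros contribute nothing
  (see \<open>S_expansion\<close> below).
\<close>

definition S :: "nat \<Rightarrow> nat \<Rightarrow> nat \<Rightarrow> nat" where
  "S c b a = c + (\<Sum>i\<le>a. (a div b ^ i mod b)\<^sup>2)"

definition U :: "nat \<Rightarrow> nat \<Rightarrow> nat set" where
  "U c b = {a. 0 < a \<and> (\<exists>m>0. (S c b ^^ m) a = a)}"

definition attracted :: "nat \<Rightarrow> nat \<Rightarrow> nat \<Rightarrow> nat \<Rightarrow> bool" where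
  "attracted c b u a \<longleftrightarrow> 0 < a \<and> (\<exists>k. (S c b ^^ k) a = u)"

definition consecutive :: "nat \<Rightarrow> nat list \<Rightarrow> bool" where
  "consecutive d xs \<longleftrightarrow>
     (\<forall>x \<in> set xs. 0 < x) \<and> (\<forall>i. Suc i < length xs \<longrightarrow> xs ! Suc i = xs ! i + d)"

lemma expansion_digit:
  fixes b n :: nat and f :: "nat \<Rightarrow> nat"
  assumes "\<And>i. i \<le> n \<Longrightarrow> f i < b"
  shows "(\<Sum>i\<le>n. f i * b ^ i) div b ^ j mod b = (if j \<le> n then f j else 0)"
  using assms
proof (induction n arbitrary: f j)
  case 0
  then show ?case by (cases j) (auto simp: div_mult2_eq)
next
  case (Suc n)
  have lt: "f 0 < b" using Suc.prems by simp
  have split: "(\<Sum>i\<le>Suc n. f i * b ^ i) = f 0 + b * (\<Sum>i\<le>n. f (Suc i) * b ^ i)"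
    by (subst sum.atMost_Suc_shift) (simp add: sum_distrib_left mult_ac)
  show ?case
  proof (cases j)
    case 0
    then show ?thesis using lt by (simp only: split) simp
  next
    case (Suc j')
    have "(\<Sum>i\<le>Suc n. f i * b ^ i) div b ^ j = (\<Sum>i\<le>n. f (Suc i) * b ^ i) div b ^ j'"
      using lt by (simp only: split Suc power_Suc div_mult2_eq) simp
    then show ?thesis
      using Suc.IH[of "\<lambda>i. f (Suc i)" j'] Suc.prems Suc by simp
  qed
qed

lemma S_expansion:
  fixes b c n :: nat and f :: "nat \<Rightarrow> nat"
  assumes b: "2 \<le> b" and f: "\<And>i. i \<le> n \<Longrightarrow> f i < b"
  shows "S c b (\<Sum>i\<le>n. f i * b ^ i) = c + (\<Sum>i\<le>n. (f i)\<^sup>2)"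
proof -
  define a where "a = (\<Sum>i\<le>n. f i * b ^ i)"
  have dig: "a div b ^ j mod b = (if j \<le> n then f j else 0)" for j
    unfolding a_def using expansion_digit[OF f] by simp
  have zero: "a div b ^ j mod b = 0" if "a < j" for j
  proof -
    have "j < 2 ^ j" by simp
    also have "\<dots> \<le> b ^ j" using b by (intro power_mono) auto
    finally show ?thesis using that by simp
  qed
  have "(\<Sum>i\<le>a. (a div b ^ i mod b)\<^sup>2) = (\<Sum>i\<le>max a n. (a div b ^ i mod b)\<^sup>2)"
    by (rule sum.mono_neutral_left) (auto simp: zero)
  also have "\<dots> = (\<Sum>i\<le>n. (a div b ^ i mod b)\<^sup>2)"
    by (rule sum.mono_neutral_right) (auto simp: dig)
  also have "\<dots> = (\<Sum>i\<le>n. (f i)\<^sup>2)"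
    by (rule sum.cong) (auto simp: dig)
  finally show ?thesis by (simp add: S_def a_def)
qed

end

theory Submission
  imports Defs "HOL-Number_Theory.Cong"
begin

text \<open>
  Call a finite set \<open>T\<close> good if some translate \<open>T + n\<close> is mapped to \<open>{u}\<close> by a single iterate
  of \<open>S\<close>. If \<open>S ` T\<close> is good then so is \<open>T\<close>: adding to \<open>t\<close> a number with digit square sum \<open>n\<close>,
  written to the left of all digits of \<open>t\<close>, adds \<open>n\<close> to \<open>S t\<close>. Singletons are good, because
  trailing zeros can be appended to \<open>u\<close>. A larger set shrinks when two of its elements are
  merged by translations and \<open>S\<close>. If \<open>y = x + (b - 1) * v\<close>, translate to \<open>b ^ r + v\<close> and
  \<open>b ^ r + b * v\<close>, which have the same nonzero digits. If only \<open>x \<equiv> y (mod d)\<close>, first achieve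
  \<open>S x \<equiv> S y (mod b - 1)\<close> by translating \<open>y\<close> to \<open>(e + 1) * b ^ r\<close>: the carry changes a digit \<open>e\<close>
  to \<open>e + 1\<close>, which contributes \<open>2 * e + 1\<close>, and \<open>e\<close> may be chosen freely.
\<close>

text \<open>Only \<open>S 0 b\<close> is additive over blocks of digits, so the digit lemmas treat
  \<open>c = 0\<close> and the constant is restored here.\<close>

lemma S_add_const: "S c b a = c + S 0 b a"
  by (simp add: S_def)

lemma S_0_0 [simp]: "S 0 b 0 = 0"
  by (simp add: S_def)

text \<open>The summation bound in \<open>S\<close> is its argument, so splitting off a digit
  changes the bound too; this makes every larger bound equivalent.\<close>

lemma sum_digits_eq_S:
  assumes "2 \<le> b" "a \<le> n"
  shows "(\<Sum>i\<le>n. (a div b ^ i mod b)\<^sup>2) = S 0 b a"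
proof -
  have "a div b ^ j mod b = 0" if "a < j" for j
  proof -
    have "j < 2 ^ j" by simp
    also have "\<dots> \<le> b ^ j" using assms by (intro power_mono) auto
    finally show ?thesis using that by simp
  qed
  then show ?thesis
    unfolding S_def using assms by (subst add_0, intro sum.mono_neutral_right) auto
qed

lemma S_0_digit:
  assumes "2 \<le> b" "x < b"
  shows "S 0 b (x + b * z) = x\<^sup>2 + S 0 b z"
proof -
  let ?a = "x + b * z"
  have "z \<le> b * z" using assms by simp
  then have "z \<le> ?a" by (rule trans_le_add2)
  have "S 0 b ?a = (\<Sum>i\<le>Suc ?a. (?a div b ^ i mod b)\<^sup>2)"
    by (rule sum_digits_eq_S[symmetric]) (use assms in auto)
  also have "\<dots> = x\<^sup>2 + (\<Sum>i\<le>?a. (z div b ^ i mod b)\<^sup>2)"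
    using assms by (subst sum.atMost_Suc_shift) (simp add: div_mult2_eq)
  also have "\<dots> = x\<^sup>2 + S 0 b z"
    using sum_digits_eq_S[OF assms(1) \<open>z \<le> ?a\<close>] by simp
  finally show ?thesis .
qed

lemma S_0_single_digit: "2 \<le> b \<Longrightarrow> x < b \<Longrightarrow> S 0 b x = x\<^sup>2"
  using S_0_digit[of b x 0] by simp

lemma S_0_concat:
  assumes "2 \<le> b" "y < b ^ r"
  shows "S 0 b (y + z * b ^ r) = S 0 b y + S 0 b z"
  using assms(2)
proof (induction r arbitrary: y)
  case 0
  then show ?case by simp
next
  case (Suc r)
  define p q where "p = y mod b" and "q = y div b"
  have p: "p < b" and y: "y = p + b * q"
    using assms(1) by (simp_all add: p_def q_def)
  have "q < b ^ r"
    using Suc.prems assms(1) by (simp add: q_def less_mult_imp_div_less mult.commute)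
  moreover have "y + z * b ^ Suc r = p + b * (q + z * b ^ r)"
    by (simp add: y algebra_simps)
  ultimately show ?case
    using Suc.IH[of q] S_0_digit[OF assms(1) p] y by (simp only: add.assoc)
qed

lemma S_mult_power:
  assumes "2 \<le> b"
  shows "S c b (z * b ^ r) = S c b z"
  using S_0_concat[OF assms, of 0 r z] assms by (simp add: S_add_const[of c])

text \<open>The induction builds the number with \<open>n\<close> digits, all equal to 1.\<close>

lemma S_0_surj:
  assumes "2 \<le> b"
  shows "\<exists>q. S 0 b q = n"
proof (induction n)
  case 0
  show ?case using S_0_0 by blast
next
  case (Suc n)
  then obtain q where "S 0 b q = n" by blast
  then have "S 0 b (1 + b * q) = Suc n"
    using S_0_digit[OF assms, of 1 q] assms by simp
  then show ?case by blast
qed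

text \<open>Each digit has the parity of its square, and powers of an odd base are odd. This
  invariance is why odd bases need \<open>d = 2\<close>.\<close>

lemma even_S_0_iff:
  assumes "2 \<le> b" "odd b"
  shows "even (S 0 b a) \<longleftrightarrow> even a"
proof (induction a rule: less_induct)
  case (less a)
  define p q where "p = a mod b" and "q = a div b"
  have p: "p < b" and a: "a = p + b * q"
    using assms(1) by (simp_all add: p_def q_def)
  show ?case
  proof (cases "a = 0")
    case False
    then have "q < a" using assms(1) by (simp add: q_def)
    then have "even (S 0 b q) \<longleftrightarrow> even q" by (rule less)
    then show ?thesis
      using S_0_digit[OF assms(1) p, of q] assms(2) by (simp add: a)
  qed simp
qed

lemma even_S_cong:
  assumes "2 \<le> b" "odd b" "even x \<longleftrightarrow> even y"
  shows "even (S c b (x + m)) \<longleftrightarrow> even (S c b (y + m))"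
  using assms even_S_0_iff[OF assms(1,2)] by (simp add: S_add_const[of c])

lemma ex_power_gt:
  fixes b :: nat
  assumes "2 \<le> b"
  shows "\<exists>r. n < b ^ r"
  using assms by (intro exI[of _ n] power_gt_expt) auto

lemma merge_cong:
  assumes b: "2 \<le> b" and cong: "[x = y] (mod (b - 1))"
  shows "\<exists>m. S c b (x + m) = S c b (y + m)"
  using cong
proof (induction x y rule: linorder_wlog)
  case (le x y)
  then have "(b - 1) dvd (y - x)"
    by (metis cong_altdef_nat cong_sym)
  then obtain v where "y - x = (b - 1) * v" by blast
  with le have y: "y = x + (b - 1) * v" by simp
  \<comment> \<open>Both \<open>v\<close> and \<open>b * v\<close> must stay clear of the leading
    digit 1, and the subtraction of \<open>x\<close> in \<open>m\<close> must not truncate.\<close>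
  obtain r where r: "b * v + x < b ^ r" using ex_power_gt[OF b] by blast
  have bv: "(b - 1) * v + v = b * v"
    using b by (cases b) auto
  define m where "m = b ^ r + v - x"
  have x_m: "x + m = v + 1 * b ^ r" using r by (simp add: m_def)
  have y_m: "y + m = b * v + 1 * b ^ r" using x_m y bv by simp
  have "v \<le> b * v" using b by simp
  then have "S 0 b (x + m) = S 0 b v + S 0 b 1"
    unfolding x_m using r by (intro S_0_concat[OF b]) linarith
  moreover have "S 0 b (y + m) = S 0 b (b * v) + S 0 b 1"
    unfolding y_m using r by (intro S_0_concat[OF b]) linarith
  moreover have "S 0 b (b * v) = S 0 b v"
    using S_0_digit[OF b, of 0 v] b by simp
  ultimately show ?case by (metis S_add_const)
next
  case (sym x y)
  then show ?case by (metis cong_sym)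
qed

lemma make_cong:
  assumes b: "2 \<le> b" and parity: "odd b \<Longrightarrow> even x \<longleftrightarrow> even y"
  shows "\<exists>m. [S c b (x + m) = S c b (y + m)] (mod (b - 1))"
  using parity
proof (induction x y rule: linorder_wlog)
  case (le x y)
  show ?case
  proof (cases "x = y")
    case False
    define w where "w = y - x"
    have w: "y = x + w" "w > 0" using le False by (auto simp: w_def)
    obtain r where r: "y < b ^ r" using ex_power_gt[OF b] by blast
    \<comment> \<open>With the \<open>m\<close> chosen below, \<open>x + m\<close> is the digit
      \<open>e\<close> followed by a block with square sum \<open>f\<close>, and
      \<open>y + m\<close> is \<open>e + 1\<close> followed by zeros. The congruence wanted is thus
      \<open>2 * e + 1 = f\<close> modulo \<open>b - 1\<close>.\<close>
    define f where "f = S 0 b (b ^ r - w)"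
    have odd_f: "odd f" if "odd b"
    proof -
      have "even w" using le(2)[OF that] w by auto
      then show ?thesis
        using even_S_0_iff[OF b that] that r w by (simp add: f_def)
    qed
    \<comment> \<open>If \<open>f\<close> is even, then \<open>b\<close> is even, and adding the odd
      modulus \<open>b - 1\<close> makes \<open>f\<close> odd.\<close>
    have "\<exists>g. [2 * g + 1 = f] (mod (b - 1))"
    proof (cases "odd f")
      case True
      then show ?thesis by (metis cong_refl oddE)
    next
      case False
      then have "odd (f + (b - 1))" using odd_f b by auto
      then obtain g where "f + (b - 1) = 2 * g + 1" by (rule oddE)
      then have "[2 * g + 1 = f] (mod (b - 1))"
        by (metis cong_add_rcancel_0_nat cong_def mod_add_self2)
      then show ?thesis by blast
    qed
    then obtain g where g: "[2 * g + 1 = f] (mod (b - 1))" by blast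
    \<comment> \<open>The reduction keeps \<open>e\<close> at most \<open>b - 2\<close>, so
      \<open>e + 1\<close> is still a digit and the carry stops there.\<close>
    define e where "e = g mod (b - 1)"
    have e: "e + 1 < b"
      using b mod_less_divisor[of "b - 1" g] unfolding e_def by linarith
    have "[e = g] (mod (b - 1))" by (simp add: e_def)
    then have "[2 * e + 1 = 2 * g + 1] (mod (b - 1))"
      by (intro cong_add cong_mult cong_refl)
    with g have "[2 * e + 1 = f] (mod (b - 1))" by (rule cong_trans[rotated])
    then have "[c + e\<^sup>2 + f = c + e\<^sup>2 + (2 * e + 1)] (mod (b - 1))"
      by (intro cong_add cong_refl) (rule cong_sym)
    define m where "m = e * b ^ r + (b ^ r - w) - x"
    have x_m: "x + m = (b ^ r - w) + e * b ^ r" using r w by (simp add: m_def)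
    have y_m: "y + m = (e + 1) * b ^ r" using x_m w r by simp
    have "S c b (x + m) = c + e\<^sup>2 + f"
      unfolding x_m using S_0_concat[OF b, of "b ^ r - w" r e] S_0_single_digit[OF b, of e] e w r
      by (simp add: S_add_const[of c] f_def)
    moreover have "S c b (y + m) = c + (e + 1)\<^sup>2"
      unfolding y_m S_mult_power[OF b] using S_0_single_digit[OF b e]
      by (simp add: S_add_const[of c])
    moreover have "(e + 1)\<^sup>2 = e\<^sup>2 + (2 * e + 1)"
      by (simp add: power2_eq_square)
    ultimately show ?thesis
      using \<open>[c + e\<^sup>2 + f = _] (mod _)\<close> by (metis add.assoc)
  qed auto
next
  case (sym x y)
  then show ?case by (metis cong_sym)
qed

definition good :: "nat \<Rightarrow> nat \<Rightarrow> nat \<Rightarrow> nat set \<Rightarrow> bool" where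
  "good c b u T \<longleftrightarrow> (\<exists>n k. \<forall>t\<in>T. (S c b ^^ k) (t + n) = u)"

lemma good_translate:
  assumes "good c b u ((\<lambda>t. t + m) ` T)"
  shows "good c b u T"
  using assms unfolding good_def by (auto simp: add.assoc)

lemma good_S:
  assumes b: "2 \<le> b" and "finite T" and "good c b u (S c b ` T)"
  shows "good c b u T"
proof -
  obtain n k where nk: "\<forall>t\<in>T. (S c b ^^ k) (S c b t + n) = u"
    using assms(3) by (auto simp: good_def)
  obtain q where q: "S 0 b q = n" using S_0_surj[OF b] by blast
  \<comment> \<open>Inserting 0 keeps \<open>Max\<close> meaningful for empty
    \<open>T\<close>.\<close>
  obtain r where r: "Max (insert 0 T) < b ^ r" using ex_power_gt[OF b] by blast
  have "(S c b ^^ Suc k) (t + q * b ^ r) = u" if "t \<in> T" for t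
  proof -
    have "t \<le> Max (insert 0 T)" using assms(2) that by simp
    with r have "t < b ^ r" by simp
    then have "S c b (t + q * b ^ r) = S c b t + n"
      using S_0_concat[OF b] q by (simp add: S_add_const[of c])
    then show ?thesis using nk that by (simp add: funpow_Suc_right del: funpow.simps)
  qed
  then show ?thesis unfolding good_def by blast
qed

lemma good_S_translate:
  assumes "2 \<le> b" "finite T" "good c b u ((\<lambda>t. S c b (t + m)) ` T)"
  shows "good c b u T"
proof (rule good_translate[of _ _ _ m], rule good_S)
  show "good c b u (S c b ` (\<lambda>t. t + m) ` T)"
    using assms(3) by (simp add: image_image)
qed (use assms in auto)

lemma good_singleton:
  assumes b: "2 \<le> b" and u: "u \<in> U c b"
  shows "good c b u {t}"
proof -
  obtain m where "u > 0" "m > 0" and m: "(S c b ^^ m) u = u"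
    using u by (auto simp: U_def)
  \<comment> \<open>At least one application of \<open>S\<close> is needed to remove the zeros
    appended to \<open>u\<close>.\<close>
  then obtain k where k: "m = Suc k" by (cases m) auto
  obtain r where "t < b ^ r" using ex_power_gt[OF b] by blast
  also have "b ^ r \<le> u * b ^ r" using \<open>u > 0\<close> by simp
  finally have "t + (u * b ^ r - t) = u * b ^ r" by simp
  moreover have "(S c b ^^ m) (u * b ^ r) = u"
    using m S_mult_power[OF b] by (simp add: k funpow_Suc_right del: funpow.simps)
  ultimately show ?thesis unfolding good_def by (metis singletonD)
qed

theorem good_finite:
  assumes b: "2 \<le> b" and u: "u \<in> U c b" and "finite T"
    and "\<And>x y. odd b \<Longrightarrow> x \<in> T \<Longrightarrow> y \<in> T \<Longrightarrow> even x \<longleftrightarrow> even y"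
  shows "good c b u T"
  using assms(3,4)
proof (induction "card T" arbitrary: T rule: less_induct)
  case less
  show ?case
  proof (cases "\<exists>x\<in>T. \<exists>y\<in>T. x \<noteq> y")
    case False
    then obtain t where "T \<subseteq> {t}" by blast
    then show ?thesis using good_singleton[OF b u, of t] unfolding good_def by blast
  next
    case True
    then obtain x y where xy: "x \<in> T" "y \<in> T" "x \<noteq> y" by blast
    obtain m where m: "[S c b (x + m) = S c b (y + m)] (mod (b - 1))"
      using make_cong[OF b] less.prems(2) xy by meson
    obtain n where n: "S c b (S c b (x + m) + n) = S c b (S c b (y + m) + n)"
      using merge_cong[OF b m] by blast
    define h where "h = (\<lambda>t. S c b (S c b (t + m) + n))"
    have "\<not> inj_on h T" using n xy by (auto simp: inj_on_def h_def)
    then have "card (h ` T) < card T"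
      using less.prems(1) by (metis card_image_le eq_card_imp_inj_on le_neq_implies_less)
    \<comment> \<open>The parity hypothesis survives passing to the image, as the induction
      requires.\<close>
    moreover have "even (h s) \<longleftrightarrow> even (h t)" if "odd b" "s \<in> T" "t \<in> T" for s t
      unfolding h_def by (intro even_S_cong b that less.prems(2))
    ultimately have "good c b u (h ` T)"
      using less.prems(1) by (intro less.hyps) auto
    then have "good c b u ((\<lambda>t. S c b (t + n)) ` (\<lambda>t. S c b (t + m)) ` T)"
      by (simp add: h_def image_image)
    then show ?thesis using less.prems(1) good_S_translate[OF b] by blast
  qed
qed

theorem theorem3p2:
  fixes c b u d :: nat
  assumes "2 \<le> b"
    and "u \<in> U c b"
    and "d = gcd 2 (b - 1)"
  shows "\<forall>N>0. \<exists>xs. length xs = N \<and> consecutive d xs \<and> (\<forall>a \<in> set xs. attracted c b u a)"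
proof (intro allI impI)
  fix N :: nat
  have "d > 0" using assms(3) by simp
  have "even d" if "odd b" using that assms(1,3) by simp
  \<comment> \<open>\<open>Suc i\<close> keeps every term positive even if the translation found is
    0.\<close>
  then have "good c b u ((\<lambda>i. d * Suc i) ` {..<N})"
    by (intro good_finite assms) auto
  then obtain n k where nk: "\<And>i. i < N \<Longrightarrow> (S c b ^^ k) (d * Suc i + n) = u"
    unfolding good_def by blast
  define xs where "xs = map (\<lambda>i. d * Suc i + n) [0..<N]"
  have "consecutive d xs"
    using \<open>d > 0\<close> by (auto simp: consecutive_def xs_def)
  moreover have "\<forall>a\<in>set xs. attracted c b u a"
    using \<open>d > 0\<close> nk by (auto simp: attracted_def xs_def simp del: mult_Suc_right intro!: exI[of _ k])
  moreover have "length xs = N" by (simp add: xs_def)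
  ultimately show "\<exists>xs. length xs = N \<and> consecutive d xs \<and> (\<forall>a\<in>set xs. attracted c b u a)"
    by blast
qed

end
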